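(* The restriction of the multivalued operations of $\mathcal O_\theta$ to $\mathcal O_K\subset\mathcal O_\theta$ coincides with the usual operations of $\mathcal O_K$: for all $x,y\in\mathcal O_K$, the sets $x+y$ and $x\cdot y$ computed in $\mathcal O_\theta$ are the singletons consisting of the (images of the) usual sum and product in $\mathcal O_K$. Thus $\mathcal O_K$ is canonically identified with a subring of $\mathcal O_\theta$.
   Context: $\theta>1$ is a real quadratic unit with $N(\theta)=-1$, so $\theta^2=a\theta+1$ with an integer $a\ge1$; $K=\mathbb Q(\theta)\subset\mathbb R$, $\mathcal O_K$ its ring of integers. A greedy polynomial is a finite sum $\sum_{i=m}^M b_i\theta^i$ with $b_i\in\{0,\dots,a\}$ such that $b_i=a$ implies $b_{i-1}=0$; every nonzero $\alpha\in\mathcal O_K$ is uniquely $\pm$ such a sum with $b_m\ne0$ (its greedy expansion), and $|\alpha|_\theta:=\theta^{-m}$, $|0|_\theta=0$. A greedy Laurent series is a formal series $x=\sum_{i\ge m}b_i\theta^i$ with $b_i\in\{0,\dots,a\}$ such that every truncation is a greedy polynomial. A sequence $(x_n)$ in $\mathcal O_K$ is a sequence of partial sums of $x$ if there are integers $M_n$, nondecreasing, $M_n\to\infty$, with $x_n=\sum_{i=m}^{M_n}b_i\theta^i+\delta_n$, $\delta_n$ a greedy polynomial involving only powers $\theta^j$, $j>M_n$. $\mathcal O_\theta^+$ is the set of greedy Laurent series, $\mathcal O_\theta=\mathcal O_\theta^+\cup(-\mathcal O_\theta^+)$, where sequences of partial sums of $-x$ are the negatives of those of $x$, and the zero series and its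 negative are identified. For $x,y,w\in\mathcal O_\theta$: $w\in x+y$ (resp. $w\in x\cdot y$) iff there are sequences of partial sums $(x_n)$ of $x$, $(y_n)$ of $y$ with $(x_n+y_n)$ (resp. $(x_ny_n)$) a sequence of partial sums of $w$. The canonical inclusion $\mathcal O_K\subset\mathcal O_\theta$ sends $\alpha>0$ to its greedy expansion (a finite series in $\mathcal O_\theta^+$), $\alpha<0$ to the negative of the greedy expansion of $-\alpha$, and $0$ to $0$.
   Formalization: The set x+y is proved a singleton only if xy>0 or x+y=0; otherwise (where it is false, e.g. 0+1 also contains an infinite negative series) only within O_K and within the series of the sign of x+y. O_K=Z[θ] is assumed, as the existence of greedy expansions in O_K forces. *)

theory Defs
  imports Complex_Main "HOL-Computational_Algebra.Computational_Algebra"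
begin

text \<open>
  A quadratic integer with trace \<open>t\<close> and norm \<open>n\<close>, i.e. an irrational root of
  \<open>X\<^sup>2 - t X + n\<close>. It is a unit iff \<open>n = 1\<close> or \<open>n = -1\<close>.
\<close>

definition quadratic_integer :: "real \<Rightarrow> int \<Rightarrow> int \<Rightarrow> bool" where
  "quadratic_integer \<theta> t n \<longleftrightarrow> \<theta> \<notin> \<rat> \<and> \<theta>\<^sup>2 - of_int t * \<theta> + of_int n = 0"

text \<open>The field \<open>\<rat>(\<theta>)\<close>, for quadratic \<open>\<theta>\<close> only.\<close>

definition quadratic_field :: "real \<Rightarrow> real set" where
  "quadratic_field \<theta> = {p + q * \<theta> |p q. p \<in> \<rat> \<and> q \<in> \<rat>}"

definition ring_of_integers :: "real set \<Rightarrow> real set" where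
  "ring_of_integers K = {x \<in> K. algebraic_int x}"

text \<open>The order \<open>\<int>[\<theta>]\<close>, for quadratic integers \<open>\<theta>\<close> only.\<close>

definition quadratic_order :: "real \<Rightarrow> real set" where
  "quadratic_order \<theta> = {of_int u + of_int v * \<theta> |u v. True}"

text \<open>
  Formal sums of powers of \<open>\<theta>\<close> are integer Laurent series, the formal variable standing
  for \<open>\<theta>\<close>. So the negative of a series is \<^term>\<open>- x\<close>, and the zero series and its
  negative are equal.
\<close>

definition greedy_poly :: "int \<Rightarrow> int fls \<Rightarrow> bool" where
  "greedy_poly a p \<longleftrightarrow>
     finite {i. fls_nth p i \<noteq> 0} \<and>
     (\<forall>i. fls_nth p i \<in> {0..a}) \<and>
     (\<forall>i. fls_nth p i = a \<longrightarrow> fls_nth p (i - 1) = 0)"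

definition fls_eval :: "real \<Rightarrow> int fls \<Rightarrow> real" where
  "fls_eval \<theta> p = (\<Sum>i | fls_nth p i \<noteq> 0. of_int (fls_nth p i) * \<theta> powi i)"

definition fls_truncate :: "int \<Rightarrow> int fls \<Rightarrow> int fls" where
  "fls_truncate N x = Abs_fls (\<lambda>i. if i \<le> N then fls_nth x i else 0)"

lemma fls_nth_truncate [simp]:
  "fls_nth (fls_truncate N x) i = (if i \<le> N then fls_nth x i else 0)"
proof -
  obtain L where "\<forall>n<L. fls_nth x n = 0"
    by (rule fls_nth_vanishes_belowE)
  then show ?thesis
    unfolding fls_truncate_def by (subst nth_Abs_fls_lower_bound[of L]) auto
qed

definition greedy_series :: "int \<Rightarrow> int fls set" where
  "greedy_series a = {x. \<forall>N. greedy_poly a (fls_truncate N x)}"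

definition O_theta :: "int \<Rightarrow> int fls set" where
  "O_theta a = greedy_series a \<union> uminus ` greedy_series a"

text \<open>
  Only the tail \<open>\<delta>\<close> is required to be greedy, not its concatenation with the truncation
  of \<open>x\<close>. All terms of the sequence automatically lie in \<open>\<int>[\<theta>]\<close> if \<open>\<theta>\<close> is a
  quadratic unit.
\<close>

definition partial_sums_pos :: "real \<Rightarrow> int \<Rightarrow> int fls \<Rightarrow> (nat \<Rightarrow> real) \<Rightarrow> bool" where
  "partial_sums_pos \<theta> a x xs \<longleftrightarrow>
     (\<exists>M :: nat \<Rightarrow> int. mono M \<and> filterlim M at_top sequentially \<and>
       (\<forall>n. \<exists>\<delta>. greedy_poly a \<delta> \<and> (\<forall>j\<le>M n. fls_nth \<delta> j = 0) \<and>
          xs n = fls_eval \<theta> (fls_truncate (M n) x) + fls_eval \<theta> \<delta>))"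

text \<open>For \<open>x = 0\<close> both alternatives apply.\<close>

definition partial_sums :: "real \<Rightarrow> int \<Rightarrow> int fls \<Rightarrow> (nat \<Rightarrow> real) \<Rightarrow> bool" where
  "partial_sums \<theta> a x xs \<longleftrightarrow>
     x \<in> greedy_series a \<and> partial_sums_pos \<theta> a x xs \<or>
     - x \<in> greedy_series a \<and> partial_sums_pos \<theta> a (- x) (\<lambda>n. - xs n)"

definition multi_add :: "real \<Rightarrow> int \<Rightarrow> int fls \<Rightarrow> int fls \<Rightarrow> int fls set" where
  "multi_add \<theta> a x y = {w \<in> O_theta a. \<exists>xs ys.
     partial_sums \<theta> a x xs \<and> partial_sums \<theta> a y ys \<and>
     partial_sums \<theta> a w (\<lambda>n. xs n + ys n)}"

definition multi_mult :: "real \<Rightarrow> int \<Rightarrow> int fls \<Rightarrow> int fls \<Rightarrow> int fls set" where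
  "multi_mult \<theta> a x y = {w \<in> O_theta a. \<exists>xs ys.
     partial_sums \<theta> a x xs \<and> partial_sums \<theta> a y ys \<and>
     partial_sums \<theta> a w (\<lambda>n. xs n * ys n)}"

definition greedy_expansion :: "real \<Rightarrow> int \<Rightarrow> real \<Rightarrow> int fls" where
  "greedy_expansion \<theta> a \<alpha> = (THE p. greedy_poly a p \<and> fls_eval \<theta> p = \<alpha>)"

definition O_K_embed :: "real \<Rightarrow> int \<Rightarrow> real \<Rightarrow> int fls" where
  "O_K_embed \<theta> a \<alpha> =
     (if \<alpha> > 0 then greedy_expansion \<theta> a \<alpha>
      else if \<alpha> < 0 then - greedy_expansion \<theta> a (- \<alpha>)
      else 0)"

end

theory Submission
  imports Defs
begin

text \<open>
  The conjugate \<open>\<tau> = -1 / \<theta>\<close> of \<open>\<theta>\<close> has modulus less than \<open>1\<close>, so evaluation at \<open>\<tau>\<close> turns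
  every sequence of partial sums into a convergent real sequence, whose limit depends only on
  the series. Hence for \<open>x, y \<in> O\<^sub>K\<close> each \<open>w \<in> x + y\<close> has the value of the conjugate of the usual
  sum at \<open>\<tau>\<close>, and similarly for products. A finite greedy expansion is the only element of
  \<open>greedy_series\<close> with its value at \<open>\<tau>\<close>, by an estimate of the first differing digit against the tails.
  So \<open>w\<close> is determined once its sign is. For products, and for summands of equal sign, the sign
  can be read off the partial sums. That every positive element of \<open>\<int>[\<theta>]\<close> has a finite
  greedy expansion follows by writing it as a sum of powers of \<open>\<theta>\<close> and carrying.
\<close>

section \<open>Digit sequences, truncation and evaluation\<close>

lemma int_set_has_greatest:
  fixes E :: "int set"
  assumes "e0 \<in> E" "\<And>i. i \<in> E \<Longrightarrow> i \<le> B"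
  obtains e where "e \<in> E" "\<And>i. i \<in> E \<Longrightarrow> i \<le> e"
proof -
  let ?F = "{i \<in> E. e0 \<le> i}"
  have fin: "finite ?F"
    using assms by (intro finite_subset[of ?F "{e0..B}"]) auto
  have "Max ?F \<in> ?F"
    using fin assms by (intro Max_in) auto
  moreover have "i \<le> Max ?F" if "i \<in> ?F" for i
    using fin that by (rule Max_ge)
  ultimately show ?thesis by (intro that[of "Max ?F"]) force+
qed

lemma fls_eval_superset:
  assumes "finite A" "{i. fls_nth p i \<noteq> 0} \<subseteq> A"
  shows "fls_eval t p = (\<Sum>i\<in>A. of_int (fls_nth p i) * t powi i)"
  unfolding fls_eval_def using assms by (intro sum.mono_neutral_left) auto

lemma greedy_polyD:
  assumes "greedy_poly a p"
  shows "finite {i. fls_nth p i \<noteq> 0}" "fls_nth p i \<ge> 0" "fls_nth p i \<le> a"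
    "fls_nth p i = a \<Longrightarrow> fls_nth p (i - 1) = 0"
  using assms by (auto simp: greedy_poly_def)

lemma greedy_poly_truncate:
  assumes "greedy_poly a p"
  shows "greedy_poly a (fls_truncate N p)"
proof -
  have "finite {i. fls_nth (fls_truncate N p) i \<noteq> 0}"
    by (rule finite_subset[OF _ greedy_polyD(1)[OF assms]]) auto
  moreover have "a \<ge> 0" using greedy_polyD(2,3)[OF assms, of 0] by linarith
  ultimately show ?thesis using assms by (auto simp: greedy_poly_def intro: order_antisym)
qed

lemma greedy_poly_in_greedy_series: "greedy_poly a p \<Longrightarrow> p \<in> greedy_series a"
  by (simp add: greedy_series_def greedy_poly_truncate)

lemma greedy_series_nonneg: "x \<in> greedy_series a \<Longrightarrow> fls_nth x i \<ge> 0"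
  using greedy_polyD(2)[of a "fls_truncate i x" i] by (simp add: greedy_series_def)

text \<open>Digits are nonnegative, so the two alternatives in \<open>partial_sums\<close> overlap
  only at the zero series.\<close>

lemma greedy_series_uminus_eq_0:
  assumes "x \<in> greedy_series a" "- x \<in> greedy_series a"
  shows "x = 0"
  using assms[THEN greedy_series_nonneg] by (intro fls_eqI) (simp add: order_antisym)

lemma fls_truncate_finite:
  assumes "finite {i. fls_nth p i \<noteq> 0}"
  obtains L where "\<And>N. N \<ge> L \<Longrightarrow> fls_truncate N p = p"
proof -
  obtain L where L: "\<And>i. fls_nth p i \<noteq> 0 \<Longrightarrow> i \<le> L"
    using bdd_above_finite[OF assms] by (auto simp: bdd_above_def)
  have "fls_truncate N p = p" if "N \<ge> L" for N
    using L that by (intro fls_eqI) force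
  then show ?thesis using that by blast
qed

lemma fls_eval_greedy_poly_nonneg:
  assumes "greedy_poly a p" "t > 0"
  shows "fls_eval t p \<ge> 0"
  unfolding fls_eval_def using assms greedy_polyD(2)[OF assms(1)]
  by (intro sum_nonneg mult_nonneg_nonneg) auto

lemma fls_eval_0 [simp]: "fls_eval t 0 = 0"
  by (simp add: fls_eval_def)

lemma fls_eval_1 [simp]: "fls_eval t 1 = 1"
  by (subst fls_eval_superset[of "{0}"]) auto

lemma partial_sums_uminus: "partial_sums \<theta> a (- x) (\<lambda>n. - xs n) \<longleftrightarrow> partial_sums \<theta> a x xs"
  by (auto simp: partial_sums_def)

section \<open>Arithmetic of the unit and its powers\<close>

locale norm_minus_one_unit =
  fixes \<theta> :: real and a :: int
  assumes gt_1: "\<theta> > 1" and quadratic: "quadratic_integer \<theta> a (- 1)"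
begin

definition \<tau> :: real where "\<tau> = of_int a - \<theta>"

lemma square: "\<theta> * \<theta> = of_int a * \<theta> + 1"
  using quadratic by (simp add: quadratic_integer_def power2_eq_square)

lemma irrational: "\<theta> \<notin> \<rat>"
  using quadratic by (simp add: quadratic_integer_def)

lemma theta_times_tau: "\<theta> * \<tau> = -1"
  using square by (simp add: \<tau>_def algebra_simps)

lemma tau_eq: "\<tau> = - inverse \<theta>"
  using theta_times_tau gt_1 by (simp add: field_simps)

lemma inverse_theta: "inverse \<theta> = \<theta> - of_int a"
  using tau_eq by (simp add: \<tau>_def)

lemma inverse_theta_bounds: "0 < inverse \<theta>" "inverse \<theta> < 1"
  using gt_1 by (simp_all add: inverse_less_1_iff)

lemma a_ge_1: "a \<ge> 1"
  using inverse_theta inverse_theta_bounds gt_1 by linarith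

lemma theta_pos: "\<theta> > 0" and theta_nonzero: "\<theta> \<noteq> 0" and tau_nonzero: "\<tau> \<noteq> 0"
  using gt_1 tau_eq by auto

lemma powi_pos: "\<theta> powi i > 0"
  using theta_pos by simp

lemma powi_add: "\<theta> powi (i + j) = \<theta> powi i * \<theta> powi j"
  by (simp add: power_int_add theta_nonzero)

lemma powi_succ: "\<theta> powi (e + 1) = of_int a * \<theta> powi e + \<theta> powi (e - 1)"
proof -
  have "\<theta> powi (e + 1) = \<theta> powi (e - 1) * (\<theta> * \<theta>)"
    using powi_add[of "e - 1" 2] by (simp add: power2_eq_square add.commute)
  also have "\<dots> = of_int a * (\<theta> powi (e - 1) * \<theta>) + \<theta> powi (e - 1)"
    by (simp add: square algebra_simps)
  finally show ?thesis by (simp add: power_int_minus_mult theta_nonzero)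
qed

text \<open>Split one of the \<open>a + 1\<close> copies of \<open>\<theta>^e\<close> one level
  down, then merge the other \<open>a\<close> with one \<open>\<theta>^(e-1)\<close>. Both sides
  consist of \<open>a + 1\<close> powers, so this carry preserves the size of a
  representation.\<close>

lemma powi_carry:
  "(of_int a + 1) * \<theta> powi e = \<theta> powi (e + 1) + (of_int a - 1) * \<theta> powi (e - 1) + \<theta> powi (e - 2)"
  using powi_succ[of e] powi_succ[of "e - 1"] by (simp add: algebra_simps)

lemma powi_bounded_above:
  obtains B where "\<And>i. \<theta> powi i \<le> x \<Longrightarrow> i \<le> B"
proof -
  obtain n where n: "x < \<theta> ^ n" using real_arch_pow[OF gt_1] by blast
  have "i \<le> int n" if "\<theta> powi i \<le> x" for i
  proof -
    have "\<theta> powi i < \<theta> powi (int n)" using that n by simp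
    then show ?thesis using gt_1 power_int_strict_increasing[of "int n" i \<theta>]
      by (metis less_eq_real_def linorder_not_less order_less_imp_le power_int_increasing)
  qed
  then show ?thesis using that by blast
qed

subsection \<open>Existence of finite expansions\<close>

text \<open>A multiset of exponents models a representation with arbitrary nonnegative digits:
  \<open>count\<close> is the digit and \<open>size\<close> the digit sum.\<close>

definition mset_value :: "int multiset \<Rightarrow> real" where
  "mset_value M = (\<Sum>i\<in>#M. \<theta> powi i)"

lemma mset_value_simps [simp]:
  "mset_value {#} = 0"
  "mset_value (add_mset i M) = \<theta> powi i + mset_value M"
  "mset_value (M + N) = mset_value M + mset_value N"
  "mset_value (replicate_mset n i) = of_nat n * \<theta> powi i"
  by (simp_all add: mset_value_def)

lemma mset_value_nonneg: "mset_value M \<ge> 0"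
  by (induction M) (use powi_pos in \<open>auto intro: add_nonneg_nonneg less_imp_le\<close>)

lemma mset_value_eq_sum:
  assumes "finite A" "set_mset M \<subseteq> A"
  shows "mset_value M = (\<Sum>i\<in>A. of_nat (count M i) * \<theta> powi i)"
  using assms(2)
proof (induction M)
  case (add x M)
  have "(\<Sum>i\<in>A. of_nat (count (add_mset x M) i) * \<theta> powi i) =
      (\<Sum>i\<in>A. (if i = x then \<theta> powi i else 0) + of_nat (count M i) * \<theta> powi i)"
    by (intro sum.cong) (auto simp: algebra_simps)
  then show ?case using add assms(1) by (simp add: sum.distrib)
qed simp

definition greedy_mset :: "int multiset \<Rightarrow> bool" where
  "greedy_mset M \<longleftrightarrow> (\<forall>i. int (count M i) \<le> a \<and> (int (count M i) = a \<longrightarrow> count M (i - 1) = 0))"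

text \<open>
  Induction on the number of powers: split off the largest power \<open>\<theta>\<^sup>e\<close> occurring in any
  representation with \<open>size M\<close> powers. Adding it to a greedy representation of the remainder
  can only violate greediness in position \<open>e\<close>, where the violation is removed by
  \<open>a \<theta>\<^sup>e + \<theta>\<^sup>e\<^sup>-\<^sup>1 = \<theta>\<^sup>e\<^sup>+\<^sup>1\<close>, which lowers the number of powers, and excluded for the digit \<open>a + 1\<close>
  by the maximality of \<open>e\<close>.
\<close>

lemma greedy_mset_exists:
  "\<exists>N. greedy_mset N \<and> mset_value N = mset_value M \<and> size N \<le> size M"
proof (induction "size M" arbitrary: M rule: less_induct)
  case less
  show ?case
  proof (cases "M = {#}")
    case True
    then show ?thesis using a_ge_1 by (intro exI[of _ "{#}"]) (auto simp: greedy_mset_def)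
  next
    case False
    define E where
      "E = {e. \<exists>N. Suc (size N) = size M \<and> \<theta> powi e + mset_value N = mset_value M}"
    obtain e0 M0 where "M = add_mset e0 M0" using False by (cases M) auto
    then have "e0 \<in> E" by (auto simp: E_def)
    obtain B where B: "\<And>i. \<theta> powi i \<le> mset_value M \<Longrightarrow> i \<le> B"
      using powi_bounded_above[of "mset_value M"] by blast
    have bound: "i \<le> B" if "i \<in> E" for i
    proof -
      obtain N where "\<theta> powi i + mset_value N = mset_value M"
        using \<open>i \<in> E\<close> unfolding E_def by blast
      then show ?thesis using B[of i] mset_value_nonneg[of N] by linarith
    qed
    obtain e where e: "e \<in> E" and e_max: "\<And>i. i \<in> E \<Longrightarrow> i \<le> e"
      using int_set_has_greatest[OF \<open>e0 \<in> E\<close> bound] by blast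
    obtain N where N: "Suc (size N) = size M" "\<theta> powi e + mset_value N = mset_value M"
      using e by (auto simp: E_def)
    obtain G where G: "greedy_mset G" "mset_value G = mset_value N" "size G \<le> size N"
      using less[of N] N(1) by auto
    have shorter: ?thesis if "size M' < size M" "mset_value M' = mset_value M" for M'
      using less[OF that(1)] that by fastforce
    define k where "k = nat a"
    have k: "int k = a" "real k = of_int a" "k \<ge> 1" using a_ge_1 by (simp_all add: k_def)
    show ?thesis
    proof (cases "size G = size N")
      case False
      then show ?thesis using shorter[of "add_mset e G"] G N by simp
    next
      case size_G: True
      \<comment> \<open>Together with \<open>e\<close>, \<open>G\<close> is again a representation
        with \<open>size M\<close> powers, so all its exponents lie in \<open>E\<close>.\<close>
      have top: "i \<le> e" if "i \<in># G" for i
      proof -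
        obtain H where "G = add_mset i H" using \<open>i \<in># G\<close> by (metis mset_add)
        then have "i \<in> E" using G N size_G
          by (auto simp: E_def intro!: exI[of _ "add_mset e H"])
        then show ?thesis by (rule e_max)
      qed
      have count_e: "count G e < k"
      proof (rule ccontr)
        assume "\<not> count G e < k"
        then obtain H where H: "G = replicate_mset k e + H"
          by (metis count_le_replicate_mset_subset_eq mset_subset_eq_exists_conv not_less)
        \<comment> \<open>With the split-off power there are \<open>a + 1\<close> copies of
          \<open>e\<close>. \<open>?N\<close> is what remains besides \<open>\<theta>^(e+1)\<close>
          after the size-preserving carry.\<close>
        let ?N = "H + replicate_mset (k - 1) (e - 1) + {#e - 2#}"
        have "mset_value M = (of_int a + 1) * \<theta> powi e + mset_value H"
          using G N H k by (simp add: algebra_simps)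
        also have "\<dots> = \<theta> powi (e + 1) + mset_value ?N"
          using k powi_carry[of e] by (simp add: of_nat_diff algebra_simps)
        finally have "e + 1 \<in> E"
          unfolding E_def using H N size_G k by (auto intro!: exI[of _ ?N])
        then show False using e_max by force
      qed
      show ?thesis
      proof (cases "count G e = k - 1 \<and> e - 1 \<in># G")
        case True
        then obtain H where H: "G = replicate_mset (k - 1) e + H"
          by (metis count_le_replicate_mset_subset_eq mset_subset_eq_exists_conv order_refl)
        have "e - 1 \<in># H" using True by (auto simp: H split: if_splits)
        then obtain H' where H': "H = add_mset (e - 1) H'" by (metis mset_add)
        have "mset_value M = mset_value (add_mset (e + 1) H')"
          using G N H H' k powi_succ[of e] by (simp add: of_nat_diff algebra_simps)
        moreover have "size (add_mset (e + 1) H') < size M"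
          using H H' N size_G k by simp
        ultimately show ?thesis using shorter by metis
      next
        case False
        have "greedy_mset (add_mset e G)"
          unfolding greedy_mset_def
        proof (intro allI conjI impI)
          fix i
          show "int (count (add_mset e G) i) \<le> a"
            using G(1) count_e k by (auto simp: greedy_mset_def)
          assume i: "int (count (add_mset e G) i) = a"
          \<comment> \<open>The digit at \<open>e + 1\<close> is \<open>0 < a\<close>, so raising
            the digit at \<open>e\<close> cannot break the condition from above.\<close>
          have "i \<noteq> e + 1"
            using i top[of "e + 1"] a_ge_1 by (auto simp: not_in_iff)
          moreover have "count G (e - 1) = 0" if "i = e"
            using False i that k by (auto simp: not_in_iff)
          ultimately show "count (add_mset e G) (i - 1) = 0"
            using G(1) i by (cases "i = e") (auto simp: greedy_mset_def)
        qed
        then show ?thesis using G N by (intro exI[of _ "add_mset e G"]) auto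
      qed
    qed
  qed
qed

lemma greedy_poly_of_mset:
  assumes "greedy_mset M"
  obtains p where "greedy_poly a p" "fls_eval \<theta> p = mset_value M"
proof -
  define p where "p = Abs_fls (\<lambda>i. int (count M i))"
  obtain L where L: "\<And>i. i \<in># M \<Longrightarrow> L \<le> i"
    using bdd_below_finite[OF finite_set_mset[of M]] by (auto simp: bdd_below_def)
  have nth: "fls_nth p i = int (count M i)" for i
    unfolding p_def using L
    by (subst nth_Abs_fls_lower_bound[of L]) (force simp: not_in_iff[symmetric])+
  have supp: "{i. fls_nth p i \<noteq> 0} = set_mset M"
    by (auto simp: nth)
  have "greedy_poly a p"
    using assms supp by (auto simp: greedy_poly_def greedy_mset_def nth)
  moreover have "fls_eval \<theta> p = mset_value M"
    using supp by (simp add: fls_eval_superset[of "set_mset M"] mset_value_eq_sum[of "set_mset M"] nth)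
  ultimately show ?thesis using that by blast
qed

subsection \<open>Conjugation\<close>

text \<open>The nontrivial automorphism of the order, given by coefficients. It is meaningful only
  on the order, where irrationality of \<open>\<theta>\<close> makes the coefficients
  unique.\<close>

definition conjugate :: "real \<Rightarrow> real" where
  "conjugate x = (THE y. \<exists>u v. x = of_int u + of_int v * \<theta> \<and> y = of_int u + of_int v * \<tau>)"

abbreviation order :: "real set" where "order \<equiv> quadratic_order \<theta>"

lemma coefficients_unique:
  assumes "of_int u + of_int v * \<theta> = of_int u' + of_int v' * \<theta>"
  shows "u = u' \<and> v = v'"
proof -
  have "v = v'"
  proof (rule ccontr)
    assume "v \<noteq> v'"
    then have "\<theta> = of_int (u' - u) / of_int (v - v')"
      using assms by (simp add: field_simps)
    then show False using irrational by (metis Rats_divide Rats_of_int)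
  qed
  then show ?thesis using assms by simp
qed

lemma conjugate_eq: "conjugate (of_int u + of_int v * \<theta>) = of_int u + of_int v * \<tau>"
  unfolding conjugate_def using coefficients_unique by (intro the_equality) blast+

lemma orderE:
  assumes "x \<in> order"
  obtains u v where "x = of_int u + of_int v * \<theta>" "conjugate x = of_int u + of_int v * \<tau>"
  using assms conjugate_eq by (auto simp: quadratic_order_def)

lemma orderI:
  assumes "x = of_int u + of_int v * \<theta>" "y = of_int u + of_int v * \<tau>"
  shows "x \<in> order \<and> conjugate x = y"
  using assms conjugate_eq by (auto simp: quadratic_order_def)

lemma tau_square: "\<tau> * \<tau> = of_int a * \<tau> + 1"
  using theta_times_tau by (simp add: \<tau>_def algebra_simps)

lemma conjugate_add:
  assumes "x \<in> order" "y \<in> order"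
  shows "x + y \<in> order \<and> conjugate (x + y) = conjugate x + conjugate y"
proof -
  from assms obtain u v u' v' where
    "x = of_int u + of_int v * \<theta>" "conjugate x = of_int u + of_int v * \<tau>"
    "y = of_int u' + of_int v' * \<theta>" "conjugate y = of_int u' + of_int v' * \<tau>"
    by (metis orderE)
  then show ?thesis by (intro orderI[of _ "u + u'" "v + v'"]) (simp_all add: algebra_simps)
qed

lemma conjugate_uminus:
  assumes "x \<in> order"
  shows "- x \<in> order \<and> conjugate (- x) = - conjugate x"
proof -
  from assms obtain u v where
    "x = of_int u + of_int v * \<theta>" "conjugate x = of_int u + of_int v * \<tau>"
    by (metis orderE)
  then show ?thesis by (intro orderI[of _ "- u" "- v"]) (simp_all add: algebra_simps)
qed

text \<open>\<open>\<theta>\<close> and \<open>\<tau>\<close> are roots of the same quadratic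
  polynomial, so the same product coefficients serve for both.\<close>

lemma conjugate_mult:
  assumes "x \<in> order" "y \<in> order"
  shows "x * y \<in> order \<and> conjugate (x * y) = conjugate x * conjugate y"
proof -
  from assms obtain u v u' v' where *:
    "x = of_int u + of_int v * \<theta>" "conjugate x = of_int u + of_int v * \<tau>"
    "y = of_int u' + of_int v' * \<theta>" "conjugate y = of_int u' + of_int v' * \<tau>"
    by (metis orderE)
  have expand: "(of_int u + of_int v * t) * (of_int u' + of_int v' * t) =
      of_int (u * u' + v * v') + of_int (u * v' + v * u' + a * v * v') * t"
    if "t * t = of_int a * t + 1" for t :: real
  proof -
    have "(of_int u + of_int v * t) * (of_int u' + of_int v' * t) =
      of_int (u * u') + of_int (u * v' + v * u') * t + of_int (v * v') * (t * t)"
      by (simp add: algebra_simps)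
    then show ?thesis using that by (simp add: algebra_simps)
  qed
  have "x * y = of_int (u * u' + v * v') + of_int (u * v' + v * u' + a * v * v') * \<theta>"
    unfolding *(1,3) by (rule expand[OF square])
  moreover have "conjugate x * conjugate y =
      of_int (u * u' + v * v') + of_int (u * v' + v * u' + a * v * v') * \<tau>"
    unfolding *(2,4) by (rule expand[OF tau_square])
  ultimately show ?thesis by (rule orderI)
qed

text \<open>As \<open>\<tau> = a - \<theta>\<close>, the conjugate of \<open>u + v \<theta>\<close>
  has coefficients \<open>u + v a\<close> and \<open>- v\<close>, which determine \<open>u\<close>
  and \<open>v\<close>.\<close>

lemma conjugate_inj:
  assumes "x \<in> order" "y \<in> order" "conjugate x = conjugate y"
  shows "x = y"
proof -
  from assms obtain u v u' v' where *:
    "x = of_int u + of_int v * \<theta>" "conjugate x = of_int u + of_int v * \<tau>"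
    "y = of_int u' + of_int v' * \<theta>" "conjugate y = of_int u' + of_int v' * \<tau>"
    by (metis orderE)
  have "of_int (u + v * a) + of_int (- v) * \<theta> = of_int (u' + v' * a) + of_int (- v') * \<theta>"
    using assms(3) * by (simp add: \<tau>_def algebra_simps)
  from coefficients_unique[OF this] show ?thesis using * by auto
qed

lemma conjugate_of_int: "of_int u \<in> order \<and> conjugate (of_int u) = of_int u"
  by (rule orderI[of _ u 0]) auto

lemma conjugate_0: "0 \<in> order" "conjugate 0 = 0"
  using conjugate_of_int[of 0] by auto

lemma conjugate_power:
  assumes "x \<in> order"
  shows "x ^ n \<in> order \<and> conjugate (x ^ n) = conjugate x ^ n"
  by (induction n) (use assms conjugate_of_int[of 1] conjugate_mult in auto)

text \<open>Negative exponents are covered because \<open>inverse \<theta> = \<theta> - a\<close>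
  lies in the order.\<close>

lemma conjugate_powi: "\<theta> powi i \<in> order \<and> conjugate (\<theta> powi i) = \<tau> powi i"
proof -
  have theta: "\<theta> \<in> order \<and> conjugate \<theta> = \<tau>"
    by (rule orderI[of _ 0 1]) auto
  have "inverse \<tau> = - \<theta>"
    using tau_eq by simp
  then have "inverse \<theta> \<in> order \<and> conjugate (inverse \<theta>) = inverse \<tau>"
    by (intro orderI[of _ "- a" 1]) (simp_all add: inverse_theta \<tau>_def)
  then show ?thesis
    using theta conjugate_power by (simp add: power_int_def)
qed

lemma conjugate_fls_eval:
  assumes "finite {i. fls_nth p i \<noteq> 0}"
  shows "fls_eval \<theta> p \<in> order \<and> conjugate (fls_eval \<theta> p) = fls_eval \<tau> p"
proof -
  have "(\<Sum>i\<in>A. of_int (fls_nth p i) * \<theta> powi i) \<in> order \<and>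
    conjugate (\<Sum>i\<in>A. of_int (fls_nth p i) * \<theta> powi i) = (\<Sum>i\<in>A. of_int (fls_nth p i) * \<tau> powi i)"
    if "finite A" for A
    using that
    by (induction A)
      (use conjugate_0 conjugate_add conjugate_mult conjugate_of_int conjugate_powi in auto)
  then show ?thesis unfolding fls_eval_def using assms by blast
qed

text \<open>
  Since the conjugate of \<open>\<theta>\<^sup>n \<alpha>\<close> tends to \<open>0\<close>, both coefficients of \<open>\<theta>\<^sup>n \<alpha> = u + v \<theta>\<close> are
  eventually positive.
\<close>

lemma mset_value_exists:
  assumes "\<alpha> \<in> order" "\<alpha> > 0"
  obtains M where "mset_value M = \<alpha>"
proof -
  have "(\<lambda>n. conjugate \<alpha> * \<tau> ^ n) \<longlonglongrightarrow> conjugate \<alpha> * 0"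
    using tau_eq inverse_theta_bounds by (intro tendsto_mult tendsto_const LIMSEQ_power_zero) auto
  \<comment> \<open>The bound \<open>\<alpha>\<close> yields \<open>v > 0\<close>, by subtracting
    the conjugate from \<open>\<alpha> \<theta>^n\<close>. The bound \<open>inverse \<theta>\<close>
    then yields \<open>u > 0\<close>, as the conjugate is \<open>u - v / \<theta>\<close> with
    \<open>v \<ge> 1\<close>.\<close>
  moreover have "min (inverse \<theta>) \<alpha> > 0"
    using assms inverse_theta_bounds by auto
  ultimately obtain n where n: "\<bar>conjugate \<alpha> * \<tau> ^ n\<bar> < min (inverse \<theta>) \<alpha>"
    using LIMSEQ_D by fastforce
  have "\<theta> ^ n \<in> order \<and> conjugate (\<theta> ^ n) = \<tau> ^ n"
    using conjugate_powi[of "int n"] by simp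
  then obtain u v where uv: "\<alpha> * \<theta> ^ n = of_int u + of_int v * \<theta>"
    "conjugate \<alpha> * \<tau> ^ n = of_int u + of_int v * \<tau>"
    using conjugate_mult[OF assms(1), of "\<theta> ^ n"] by (metis orderE)
  have "\<alpha> * 1 \<le> \<alpha> * \<theta> ^ n"
    using assms gt_1 by (intro mult_left_mono) auto
  then have "of_int v * (\<theta> - \<tau>) > 0"
    using uv n by (simp add: algebra_simps) linarith
  moreover have "\<theta> - \<tau> > 0"
    using tau_eq theta_pos inverse_theta_bounds by linarith
  ultimately have v: "v > 0" by (simp add: zero_less_mult_iff)
  have "1 * inverse \<theta> \<le> of_int v * inverse \<theta>"
    using v inverse_theta_bounds by (intro mult_right_mono) auto
  then have "of_int u > (0::real)" using uv n tau_eq by simp linarith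
  then have u: "u > 0" by simp
  have "\<alpha> = \<theta> powi (- int n) * (\<alpha> * \<theta> ^ n)"
    using theta_nonzero by (simp add: power_int_minus field_simps)
  also have "\<dots> = of_int u * \<theta> powi (- int n) + of_int v * \<theta> powi (1 - int n)"
    using powi_add[of "- int n" 1] by (simp add: uv algebra_simps)
  also have "\<dots> = mset_value (replicate_mset (nat u) (- int n) + replicate_mset (nat v) (1 - int n))"
    using u v by simp
  finally show ?thesis using that by metis
qed

lemma greedy_poly_exists:
  assumes "\<alpha> \<in> order" "\<alpha> > 0"
  shows "\<exists>p. greedy_poly a p \<and> fls_eval \<theta> p = \<alpha>"
  using mset_value_exists[OF assms] greedy_mset_exists greedy_poly_of_mset by metis

subsection \<open>Tails and uniqueness of finite expansions\<close>

text \<open>The value at \<open>\<tau>\<close> of the part above \<open>m\<close>, scaled by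
  \<open>\<tau>^(-m)\<close> so that bounds do not depend on \<open>m\<close>.\<close>

definition tail :: "int fls \<Rightarrow> int \<Rightarrow> real" where
  "tail p m = (\<Sum>i | fls_nth p i \<noteq> 0 \<and> m < i. of_int (fls_nth p i) * \<tau> powi (i - m))"

lemma tail_pred:
  assumes "finite {i. fls_nth p i \<noteq> 0}"
  shows "tail p (m - 1) = \<tau> * (of_int (fls_nth p m) + tail p m)"
proof -
  let ?A = "{i. fls_nth p i \<noteq> 0 \<and> m < i}"
  have fin: "finite ?A" using assms by (rule rev_finite_subset) auto
  have "tail p (m - 1) = (\<Sum>i\<in>insert m ?A. of_int (fls_nth p i) * \<tau> powi (i - (m - 1)))"
    unfolding tail_def using fin by (intro sum.mono_neutral_left) auto
  also have "\<dots> = of_int (fls_nth p m) * \<tau> + (\<Sum>i\<in>?A. of_int (fls_nth p i) * \<tau> powi (i - m + 1))"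
    using fin by (simp add: algebra_simps)
  also have "(\<Sum>i\<in>?A. of_int (fls_nth p i) * \<tau> powi (i - m + 1)) = \<tau> * tail p m"
    unfolding tail_def sum_distrib_left
    by (intro sum.cong) (auto simp: power_int_add tau_nonzero)
  finally show ?thesis by (simp add: algebra_simps)
qed

lemma fls_eval_split:
  assumes "finite {i. fls_nth p i \<noteq> 0}"
  shows "fls_eval \<tau> p = (\<Sum>i | fls_nth p i \<noteq> 0 \<and> i < m. of_int (fls_nth p i) * \<tau> powi i)
    + \<tau> powi m * (of_int (fls_nth p m) + tail p m)"
proof -
  let ?A = "{i. fls_nth p i \<noteq> 0 \<and> m < i}" and ?B = "{i. fls_nth p i \<noteq> 0 \<and> i < m}"
  have fin: "finite ?A" "finite ?B" using assms by (auto elim: rev_finite_subset)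
  have "fls_eval \<tau> p = (\<Sum>i\<in>?B \<union> insert m ?A. of_int (fls_nth p i) * \<tau> powi i)"
    using fin by (intro fls_eval_superset) auto
  also have "\<dots> = (\<Sum>i\<in>?B. of_int (fls_nth p i) * \<tau> powi i) +
      (of_int (fls_nth p m) * \<tau> powi m + (\<Sum>i\<in>?A. of_int (fls_nth p i) * \<tau> powi i))"
    using fin by (subst sum.union_disjoint) auto
  also have "(\<Sum>i\<in>?A. of_int (fls_nth p i) * \<tau> powi i) = \<tau> powi m * tail p m"
    unfolding tail_def sum_distrib_left
    by (intro sum.cong) (auto simp: power_int_add[symmetric] tau_nonzero)
  finally show ?thesis by (simp add: algebra_simps)
qed

text \<open>
  The extremal tails are \<open>-1\<close> (digits \<open>a, 0, a, 0, \<dots>\<close>), \<open>1 / \<theta>\<close> (digits \<open>0, a, 0, a, \<dots>\<close>) and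
  \<open>-1 + 1 / \<theta>\<close> (digits \<open>a - 1, 0, a, 0, a, \<dots>\<close>). They need infinitely many digits, hence the
  strict inequalities.
\<close>

lemma tail_bounds:
  assumes "greedy_poly a p"
  shows "-1 < tail p m \<and> tail p m < inverse \<theta> \<and>
    (fls_nth p (m + 1) \<noteq> a \<longrightarrow> inverse \<theta> - 1 < tail p m)"
proof -
  obtain L where L: "\<And>i. fls_nth p i \<noteq> 0 \<Longrightarrow> i \<le> L"
    using bdd_above_finite[OF greedy_polyD(1)[OF assms]] by (auto simp: bdd_above_def)
  \<comment> \<open>The induction descends from an index beyond which all digits vanish, where the
    tail is \<open>0\<close>.\<close>
  have "m \<le> max m L" by simp
  then show ?thesis
  proof (induction m rule: int_le_induct)
    case base
    have "{i. fls_nth p i \<noteq> 0 \<and> max m L < i} = {}" using L by force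
    then have "tail p (max m L) = 0" by (simp only: tail_def sum.empty)
    then show ?case using inverse_theta_bounds by simp
  next
    case (step m)
    \<comment> \<open>The next tail is \<open>- s / \<theta>\<close>, so upper and lower bounds
      trade places: \<open>-1 < s < a + 1 / \<theta> = \<theta>\<close>, and
      \<open>s < \<theta> - 1\<close> if the digit is not \<open>a\<close>.\<close>
    define s where "s = of_int (fls_nth p m) + tail p m"
    have eq: "tail p (m - 1) = - (inverse \<theta> * s)"
      using tail_pred[OF greedy_polyD(1)[OF assms]] by (simp add: tau_eq s_def)
    have inv: "\<theta> * inverse \<theta> = 1" using theta_nonzero by simp
    have "of_int (fls_nth p m) \<ge> (0::real)"
      using greedy_polyD(2)[OF assms, of m] by simp
    then have "s > -1" using step by (simp add: s_def)
    then have "inverse \<theta> * s > inverse \<theta> * (-1)"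
      using inverse_theta_bounds by (intro mult_strict_left_mono) auto
    moreover have "of_int (fls_nth p m) \<le> (of_int a :: real)"
      using greedy_polyD(3)[OF assms, of m] by simp
    then have "s < \<theta>" using step inverse_theta by (simp add: s_def)
    then have "inverse \<theta> * s < inverse \<theta> * \<theta>"
      using inverse_theta_bounds by (intro mult_strict_left_mono) auto
    moreover have "inverse \<theta> * s < inverse \<theta> * (\<theta> - 1)" if "fls_nth p m \<noteq> a"
    proof -
      have "fls_nth p m \<le> a - 1" using greedy_polyD(3)[OF assms, of m] that by simp
      then have "of_int (fls_nth p m) \<le> (of_int (a - 1) :: real)" by (simp only: of_int_le_iff)
      then have "s < \<theta> - 1" using step inverse_theta by (simp add: s_def)
      then show ?thesis using inverse_theta_bounds by (intro mult_strict_left_mono) auto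
    qed
    ultimately show ?case unfolding eq using inv by (auto simp: algebra_simps)
  qed
qed

text \<open>
  Two series that first differ at \<open>m\<close>: the digit difference at \<open>m\<close> is at least \<open>1\<close>, and the
  difference of the tails is at least \<open>-1\<close>, since the larger digit at \<open>m\<close> is not followed by \<open>a\<close>.
  Finiteness of \<open>p\<close> makes the inequality strict, uniformly in the truncation.
\<close>

lemma greedy_separation:
  assumes "greedy_poly a p" "w \<in> greedy_series a" "w \<noteq> p"
  obtains \<epsilon> N0 where "\<epsilon> > 0"
    "\<And>N. N \<ge> N0 \<Longrightarrow> \<epsilon> \<le> \<bar>fls_eval \<tau> (fls_truncate N w) - fls_eval \<tau> p\<bar>"
proof -
  define m where "m = fls_subdegree (w - p)"
  have below: "fls_nth w i = fls_nth p i" if "i < m" for i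
    using fls_eq0_below_subdegree[of i "w - p"] that by (simp add: m_def)
  have at: "fls_nth w m \<noteq> fls_nth p m"
    using nth_fls_subdegree_nonzero[of "w - p"] assms(3) by (simp add: m_def)
  have trunc: "greedy_poly a (fls_truncate N w)" for N
    using assms(2) by (simp add: greedy_series_def)
  define d where "d N = of_int (fls_nth w m) - of_int (fls_nth p m)
    + tail (fls_truncate N w) m - tail p m" for N
  have diff: "fls_eval \<tau> (fls_truncate N w) - fls_eval \<tau> p = \<tau> powi m * d N" if "N \<ge> m" for N
  proof -
    have "(\<Sum>i | fls_nth (fls_truncate N w) i \<noteq> 0 \<and> i < m.
          of_int (fls_nth (fls_truncate N w) i) * \<tau> powi i)
        = (\<Sum>i | fls_nth p i \<noteq> 0 \<and> i < m. of_int (fls_nth p i) * \<tau> powi i)"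
      using that by (intro sum.cong) (auto simp: below)
    then show ?thesis using that
      unfolding fls_eval_split[OF greedy_polyD(1)[OF trunc], of N m]
        fls_eval_split[OF greedy_polyD(1)[OF assms(1)], of m] d_def
      by (simp add: algebra_simps)
  qed
  obtain c where c: "c > 0" "\<And>N. N \<ge> m \<Longrightarrow> c \<le> \<bar>d N\<bar>"
  proof (cases "fls_nth w m > fls_nth p m")
    case True
    have next_digit: "fls_nth (fls_truncate N w) (m + 1) \<noteq> a" if "N \<ge> m" for N
      using greedy_polyD(4)[OF trunc, of N "m + 1"] greedy_polyD(2)[OF assms(1), of m] True that
      by auto
    have "of_int (fls_nth p m + 1) \<le> (of_int (fls_nth w m) :: real)"
      using True by (simp only: of_int_le_iff)
    \<comment> \<open>The digits contribute at least \<open>1\<close> and the tail of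
      \<open>w\<close> more than \<open>inverse \<theta> - 1\<close>. The resulting bound depends on
      \<open>p\<close> and \<open>m\<close> only and is positive by the strict upper bound on
      \<open>tail p m\<close>.\<close>
    then have "inverse \<theta> - tail p m \<le> \<bar>d N\<bar>" if "N \<ge> m" for N
      using tail_bounds[OF trunc, of N m] next_digit[OF that] unfolding d_def
      by (intro order_trans[OF _ abs_ge_self]) simp
    then show ?thesis using that[of "inverse \<theta> - tail p m"] tail_bounds[OF assms(1), of m] by simp
  next
    case False
    then have less: "fls_nth w m < fls_nth p m" using at by simp
    have "fls_nth p (m + 1) \<noteq> a"
      using greedy_polyD(4)[OF assms(1), of "m + 1"] greedy_series_nonneg[OF assms(2), of m] less
      by auto
    then have "1 - inverse \<theta> + tail p m > 0"
      using tail_bounds[OF assms(1), of m] by simp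
    moreover have "of_int (fls_nth w m + 1) \<le> (of_int (fls_nth p m) :: real)"
      using less by (simp only: of_int_le_iff)
    then have "1 - inverse \<theta> + tail p m \<le> \<bar>d N\<bar>" for N
      using tail_bounds[OF trunc, of N m] unfolding d_def
      by (intro order_trans[OF _ abs_ge_minus_self]) simp
    ultimately show ?thesis using that by blast
  qed
  show ?thesis
  proof (rule that[of "\<bar>\<tau> powi m\<bar> * c" m])
    show "\<bar>\<tau> powi m\<bar> * c > 0" using c tau_nonzero by simp
    show "\<bar>\<tau> powi m\<bar> * c \<le> \<bar>fls_eval \<tau> (fls_truncate N w) - fls_eval \<tau> p\<bar>" if "N \<ge> m" for N
      using diff[OF that] c(2)[OF that] by (simp add: abs_mult mult_left_mono)
  qed
qed

text \<open>Conjugation carries equality at \<open>\<theta>\<close> to equality at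
  \<open>\<tau>\<close>, which the separation of distinct expansions forbids.\<close>

lemma greedy_poly_unique:
  assumes "greedy_poly a p" "greedy_poly a q" "fls_eval \<theta> p = fls_eval \<theta> q"
  shows "p = q"
proof (rule ccontr)
  assume "p \<noteq> q"
  then obtain \<epsilon> N0 where *: "\<epsilon> > 0"
    "\<And>N. N \<ge> N0 \<Longrightarrow> \<epsilon> \<le> \<bar>fls_eval \<tau> (fls_truncate N p) - fls_eval \<tau> q\<bar>"
    using greedy_separation[OF assms(2) greedy_poly_in_greedy_series[OF assms(1)]] by metis
  obtain L where L: "\<And>N. N \<ge> L \<Longrightarrow> fls_truncate N p = p"
    using fls_truncate_finite[OF greedy_polyD(1)[OF assms(1)]] by blast
  have "fls_eval \<tau> p = fls_eval \<tau> q"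
    using conjugate_fls_eval assms greedy_polyD(1) by metis
  then show False using *(1) *(2)[of "max N0 L"] L[of "max N0 L"] by simp
qed

subsection \<open>Sequences of partial sums\<close>

text \<open>Scaled tails have modulus at most \<open>1\<close>. Hence the free tails in a sequence
  of partial sums vanish at \<open>\<tau>\<close> in the limit.\<close>

lemma fls_eval_tau_bound:
  assumes "greedy_poly a \<delta>" "\<forall>j\<le>M. fls_nth \<delta> j = 0"
  shows "\<bar>fls_eval \<tau> \<delta>\<bar> \<le> \<bar>\<tau>\<bar> powi M"
proof -
  have "{i. fls_nth \<delta> i \<noteq> 0 \<and> i < M} = {}" using assms(2) by auto
  then have "fls_eval \<tau> \<delta> = \<tau> powi M * tail \<delta> M"
    unfolding fls_eval_split[OF greedy_polyD(1)[OF assms(1)], of M] using assms(2) by simp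
  moreover have "\<bar>tail \<delta> M\<bar> \<le> 1"
    using tail_bounds[OF assms(1), of M] inverse_theta_bounds by linarith
  ultimately show ?thesis
    by (simp add: abs_mult power_int_abs mult_left_le)
qed

text \<open>The inequality at \<open>\<theta>\<close> controls signs, since the free tails are
  nonnegative there; the limit at \<open>\<tau>\<close> identifies the series.\<close>

lemma partial_sums_posE:
  assumes "w \<in> greedy_series a" "partial_sums_pos \<theta> a w ws"
  obtains M where "filterlim M at_top sequentially"
    "\<And>n. ws n \<in> order" "\<And>n. fls_eval \<theta> (fls_truncate (M n) w) \<le> ws n"
    "(\<lambda>n. conjugate (ws n) - fls_eval \<tau> (fls_truncate (M n) w)) \<longlonglongrightarrow> 0"
proof -
  obtain M \<delta> where M: "filterlim M at_top sequentially" and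
    \<delta>: "\<And>n. greedy_poly a (\<delta> n)" "\<And>n. \<forall>j\<le>M n. fls_nth (\<delta> n) j = 0" and
    ws: "\<And>n. ws n = fls_eval \<theta> (fls_truncate (M n) w) + fls_eval \<theta> (\<delta> n)"
    using assms(2) unfolding partial_sums_pos_def by metis
  have trunc: "greedy_poly a (fls_truncate N w)" for N
    using assms(1) by (simp add: greedy_series_def)
  have conj: "ws n \<in> order \<and>
      conjugate (ws n) = fls_eval \<tau> (fls_truncate (M n) w) + fls_eval \<tau> (\<delta> n)" for n
    unfolding ws using conjugate_add conjugate_fls_eval greedy_polyD(1)[OF trunc]
      greedy_polyD(1)[OF \<delta>(1)] by metis
  \<comment> \<open>The cut-offs may start negative; they are eventually nonnegative, and from then
    on \<open>nat\<close> changes nothing.\<close>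
  have "filterlim (\<lambda>n. nat (M n)) at_top sequentially"
    using filterlim_compose[OF filterlim_nat_sequentially M] by simp
  then have "(\<lambda>n. \<bar>\<tau>\<bar> ^ nat (M n)) \<longlonglongrightarrow> 0"
    using tau_eq inverse_theta_bounds
    by (intro filterlim_compose[OF LIMSEQ_power_zero]) auto
  moreover have "eventually (\<lambda>n. norm (fls_eval \<tau> (\<delta> n)) \<le> norm (\<bar>\<tau>\<bar> ^ nat (M n)) * 1) sequentially"
    using eventually_compose_filterlim[OF eventually_ge_at_top[of 0] M]
    by eventually_elim (use fls_eval_tau_bound[OF \<delta>] in \<open>simp add: power_int_nonneg_exp[symmetric]\<close>)
  ultimately have "(\<lambda>n. fls_eval \<tau> (\<delta> n)) \<longlonglongrightarrow> 0"
    by (rule tendsto_0_le)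
  then show ?thesis
    using that[OF M] conj fls_eval_greedy_poly_nonneg[OF \<delta>(1) theta_pos] ws by simp
qed

lemma partial_sums_pos_greedy_poly:
  assumes "greedy_poly a p" "partial_sums_pos \<theta> a p xs"
  shows "xs n \<in> order" "eventually (\<lambda>n. fls_eval \<theta> p \<le> xs n) sequentially"
    "(\<lambda>n. conjugate (xs n)) \<longlonglongrightarrow> fls_eval \<tau> p"
proof -
  obtain M where M: "filterlim M at_top sequentially" and
    xs: "\<And>n. xs n \<in> order" "\<And>n. fls_eval \<theta> (fls_truncate (M n) p) \<le> xs n"
    "(\<lambda>n. conjugate (xs n) - fls_eval \<tau> (fls_truncate (M n) p)) \<longlonglongrightarrow> 0"
    using partial_sums_posE[OF greedy_poly_in_greedy_series[OF assms(1)] assms(2)] by metis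
  obtain L where L: "\<And>N. N \<ge> L \<Longrightarrow> fls_truncate N p = p"
    using fls_truncate_finite[OF greedy_polyD(1)[OF assms(1)]] by blast
  have ev: "eventually (\<lambda>n. fls_truncate (M n) p = p) sequentially"
    using eventually_compose_filterlim[OF eventually_ge_at_top[of L] M]
    by eventually_elim (rule L)
  show "xs n \<in> order" by (rule xs(1))
  show "eventually (\<lambda>n. fls_eval \<theta> p \<le> xs n) sequentially"
    using ev by eventually_elim (use xs(2) in metis)
  have "(\<lambda>n. conjugate (xs n) - fls_eval \<tau> p) \<longlonglongrightarrow> 0"
    using xs(3) by (rule Lim_transform_eventually) (use ev in eventually_elim, simp)
  then show "(\<lambda>n. conjugate (xs n)) \<longlonglongrightarrow> fls_eval \<tau> p"
    by (simp add: LIM_zero_iff)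
qed

text \<open>Otherwise the truncations of \<open>w\<close> would keep a fixed distance from
  \<open>p\<close> at \<open>\<tau>\<close>, by \<open>greedy_separation\<close>.\<close>

lemma greedy_series_eq_if_limit:
  assumes "w \<in> greedy_series a" "partial_sums_pos \<theta> a w ws"
    and "greedy_poly a p" "(\<lambda>n. conjugate (ws n)) \<longlonglongrightarrow> fls_eval \<tau> p"
  shows "w = p"
proof (rule ccontr)
  assume "w \<noteq> p"
  then obtain \<epsilon> N0 where sep: "\<epsilon> > 0"
    "\<And>N. N \<ge> N0 \<Longrightarrow> \<epsilon> \<le> \<bar>fls_eval \<tau> (fls_truncate N w) - fls_eval \<tau> p\<bar>"
    using greedy_separation[OF assms(3,1)] by metis
  obtain M where M: "filterlim M at_top sequentially" and
    ws: "(\<lambda>n. conjugate (ws n) - fls_eval \<tau> (fls_truncate (M n) w)) \<longlonglongrightarrow> 0"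
    using partial_sums_posE[OF assms(1,2)] by metis
  have "(\<lambda>n. fls_eval \<tau> (fls_truncate (M n) w)) \<longlonglongrightarrow> fls_eval \<tau> p"
    using tendsto_diff[OF assms(4) ws] by simp
  then have "eventually (\<lambda>n. \<bar>fls_eval \<tau> (fls_truncate (M n) w) - fls_eval \<tau> p\<bar> < \<epsilon>) sequentially"
    using sep(1) by (auto simp: tendsto_iff dist_real_def)
  moreover have "eventually (\<lambda>n. \<epsilon> \<le> \<bar>fls_eval \<tau> (fls_truncate (M n) w) - fls_eval \<tau> p\<bar>) sequentially"
    using eventually_compose_filterlim[OF eventually_ge_at_top[of N0] M]
    by eventually_elim (rule sep(2))
  ultimately have "eventually (\<lambda>n. False) sequentially"
    by eventually_elim simp
  then show False by simp
qed

subsection \<open>The embedding of the ring of integers\<close>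

abbreviation \<iota> :: "real \<Rightarrow> int fls" where "\<iota> \<equiv> O_K_embed \<theta> a"

lemma greedy_poly_0: "greedy_poly a 0"
  using a_ge_1 by (simp add: greedy_poly_def)

lemma greedy_poly_1: "greedy_poly a 1"
  using a_ge_1 by (auto simp: greedy_poly_def)

lemma greedy_expansion_eqI: "greedy_poly a p \<Longrightarrow> fls_eval \<theta> p = \<alpha> \<Longrightarrow> greedy_expansion \<theta> a \<alpha> = p"
  unfolding greedy_expansion_def using greedy_poly_unique by (intro the_equality) blast+

lemma embed_0: "\<iota> 0 = 0"
  by (simp add: O_K_embed_def)

lemma embed_1: "\<iota> 1 = 1"
  by (simp add: O_K_embed_def greedy_expansion_eqI[OF greedy_poly_1])

lemma embed_uminus: "\<iota> (- x) = - \<iota> x"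
  by (simp add: O_K_embed_def)

lemma embed_nonneg:
  assumes "x \<in> order" "x \<ge> 0"
  shows "greedy_poly a (\<iota> x)" "fls_eval \<theta> (\<iota> x) = x"
proof -
  have "greedy_poly a (\<iota> x) \<and> fls_eval \<theta> (\<iota> x) = x"
  proof (cases "x = 0")
    case True
    then show ?thesis by (simp add: embed_0 greedy_poly_0)
  next
    case False
    then obtain p where "greedy_poly a p" "fls_eval \<theta> p = x"
      using greedy_poly_exists[of x] assms by auto
    then show ?thesis using False assms by (simp add: O_K_embed_def greedy_expansion_eqI)
  qed
  then show "greedy_poly a (\<iota> x)" "fls_eval \<theta> (\<iota> x) = x" by auto
qed

lemma embed_conjugate:
  assumes "x \<in> order" "x \<ge> 0"
  shows "fls_eval \<tau> (\<iota> x) = conjugate x"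
  using conjugate_fls_eval[OF greedy_polyD(1)[OF embed_nonneg(1)[OF assms]]]
    embed_nonneg(2)[OF assms] by simp

text \<open>\<open>\<iota>\<close> and \<open>partial_sums\<close> respect negation, so claims about
  embedded elements reduce to nonnegative ones.\<close>

lemma order_sign_cases [consumes 1, case_names nonneg uminus]:
  assumes "x \<in> order"
    and "\<And>x. x \<in> order \<Longrightarrow> x \<ge> 0 \<Longrightarrow> P x"
    and "\<And>x. x \<in> order \<Longrightarrow> x \<ge> 0 \<Longrightarrow> P x \<Longrightarrow> P (- x)"
  shows "P x"
proof (cases "x \<ge> 0")
  case False
  then show ?thesis
    using assms(2)[of "- x"] assms(3)[of "- x"] conjugate_uminus[OF assms(1)] by simp
qed (use assms in blast)

lemma embed_in_O_theta:
  assumes "x \<in> order"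
  shows "\<iota> x \<in> O_theta a"
  using assms
  by (cases rule: order_sign_cases)
    (auto simp: O_theta_def embed_uminus embed_nonneg greedy_poly_in_greedy_series)

text \<open>Constant sequences witness that the usual sum and product belong to the multivalued
  ones.\<close>

lemma partial_sums_const:
  assumes "x \<in> order"
  shows "partial_sums \<theta> a (\<iota> x) (\<lambda>n. x)"
  using assms
proof (induction x rule: order_sign_cases)
  case (nonneg x)
  note p = embed_nonneg[OF nonneg]
  obtain L where L: "\<And>N. N \<ge> L \<Longrightarrow> fls_truncate N (\<iota> x) = \<iota> x"
    using fls_truncate_finite[OF greedy_polyD(1)[OF p(1)]] by blast
  have "filterlim (\<lambda>n. L + int n) at_top sequentially"
    unfolding filterlim_at_top eventually_sequentially
  proof (intro allI)
    fix Z
    show "\<exists>N. \<forall>n\<ge>N. Z \<le> L + int n" by (intro exI[of _ "nat (Z - L)"]) auto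
  qed
  then have "partial_sums_pos \<theta> a (\<iota> x) (\<lambda>n. x)"
    unfolding partial_sums_pos_def using L p greedy_poly_0
    by (intro exI[of _ "\<lambda>n. L + int n"]) (auto simp: mono_def intro!: exI[of _ 0])
  then show ?case using p by (simp add: partial_sums_def greedy_poly_in_greedy_series)
next
  case (uminus x)
  then show ?case
    using partial_sums_uminus[of \<theta> a "\<iota> x" "\<lambda>n. x"] by (simp add: embed_uminus)
qed

text \<open>For \<open>x \<ge> 0\<close> the truncations of the finite expansion eventually equal
  it. So the terms are eventually at least \<open>x\<close>, and their conjugates tend to that of
  \<open>x\<close>.\<close>

lemma partial_sums_embed:
  assumes "x \<in> order" "partial_sums \<theta> a (\<iota> x) xs"
  shows "(\<forall>n. xs n \<in> order) \<and> (\<lambda>n. conjugate (xs n)) \<longlonglongrightarrow> conjugate x \<and>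
    (x > 0 \<longrightarrow> eventually (\<lambda>n. xs n > 0) sequentially) \<and>
    (x < 0 \<longrightarrow> eventually (\<lambda>n. xs n < 0) sequentially)"
  using assms
proof (induction x arbitrary: xs rule: order_sign_cases)
  case (nonneg x)
  note p = embed_nonneg[OF nonneg(1,2)]
  show ?case
  proof (cases "partial_sums_pos \<theta> a (\<iota> x) xs")
    case True
    note ps = partial_sums_pos_greedy_poly[OF p(1) True]
    have "eventually (\<lambda>n. xs n > 0) sequentially" if "x > 0"
      using ps(2) by eventually_elim (use that p(2) in simp)
    then show ?thesis using ps nonneg embed_conjugate[OF nonneg(1,2)] by auto
  next
    case False
    then have *: "- \<iota> x \<in> greedy_series a" "partial_sums_pos \<theta> a (- \<iota> x) (\<lambda>n. - xs n)"
      using nonneg(3) by (auto simp: partial_sums_def)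
    \<comment> \<open>The negative alternative for a nonnegative \<open>x\<close> leaves only the
      zero series.\<close>
    have "\<iota> x = 0"
      using greedy_series_uminus_eq_0[OF greedy_poly_in_greedy_series[OF p(1)] *(1)] .
    then have "x = 0" "partial_sums_pos \<theta> a 0 (\<lambda>n. - xs n)" using p(2) * by auto
    note ps = partial_sums_pos_greedy_poly[OF greedy_poly_0 this(2)]
    have xs: "xs n \<in> order \<and> conjugate (- xs n) = - conjugate (xs n)" for n
      using conjugate_uminus[OF ps(1)[of n]] by simp
    then have "(\<lambda>n. conjugate (xs n)) \<longlonglongrightarrow> 0"
      using ps(3) tendsto_minus_cancel_left[of "\<lambda>n. conjugate (xs n)" 0] by simp
    then show ?thesis using xs \<open>x = 0\<close> by (simp add: conjugate_0)
  qed
next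
  case (uminus x)
  have "partial_sums \<theta> a (\<iota> x) (\<lambda>n. - xs n)"
    using uminus(4) partial_sums_uminus[of \<theta> a "\<iota> x" "\<lambda>n. - xs n"] by (simp add: embed_uminus)
  note IH = uminus(3)[OF this]
  have xs: "xs n \<in> order \<and> conjugate (- xs n) = - conjugate (xs n)" for n
    using conjugate_uminus[of "- xs n"] IH by simp
  have "(\<lambda>n. conjugate (xs n)) \<longlonglongrightarrow> - conjugate x"
    using IH tendsto_minus_cancel_left[of "\<lambda>n. conjugate (xs n)" "conjugate x"] xs by simp
  then show ?case using IH xs conjugate_uminus[OF uminus(1)] by simp
qed

lemma partial_sums_limit_embedded:
  assumes "t \<in> order" "z \<in> order" "partial_sums \<theta> a (\<iota> t) ws"
    "(\<lambda>n. conjugate (ws n)) \<longlonglongrightarrow> conjugate z"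
  shows "t = z"
  using partial_sums_embed[OF assms(1,3)] assms(4) conjugate_inj[OF assms(1,2)] LIMSEQ_unique
  by blast

text \<open>One disjunct for each sign of \<open>w\<close>. The limit identifies \<open>w\<close>
  only if \<open>z\<close> has a compatible sign; the sign of the terms \<open>ws n\<close> serves
  to rule out the other disjunct.\<close>

lemma partial_sums_limit:
  assumes "z \<in> order" "partial_sums \<theta> a w ws" "\<And>n. ws n \<in> order"
    "(\<lambda>n. conjugate (ws n)) \<longlonglongrightarrow> conjugate z"
  shows "w \<in> greedy_series a \<and> (\<forall>n. ws n \<ge> 0) \<and> (z \<ge> 0 \<longrightarrow> w = \<iota> z) \<or>
    - w \<in> greedy_series a \<and> (\<forall>n. ws n \<le> 0) \<and> (z \<le> 0 \<longrightarrow> w = \<iota> z)"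
proof -
  have pos: "(\<forall>n. ws n \<ge> 0) \<and> (z \<ge> 0 \<longrightarrow> w = \<iota> z)"
    if z: "z \<in> order" and w: "w \<in> greedy_series a" "partial_sums_pos \<theta> a w ws"
      and lim: "(\<lambda>n. conjugate (ws n)) \<longlonglongrightarrow> conjugate z" for z w ws
  proof -
    have trunc: "greedy_poly a (fls_truncate N w)" for N
      using w(1) by (simp add: greedy_series_def)
    obtain M where "\<And>n. fls_eval \<theta> (fls_truncate (M n) w) \<le> ws n"
      using partial_sums_posE[OF w] by metis
    then have "ws n \<ge> 0" for n
      using fls_eval_greedy_poly_nonneg[OF trunc theta_pos] order_trans by blast
    moreover have "w = \<iota> z" if "z \<ge> 0"
      using greedy_series_eq_if_limit[OF w embed_nonneg(1)[OF z that]]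
        embed_conjugate[OF z that] lim by simp
    ultimately show ?thesis by blast
  qed
  from assms(2) consider "w \<in> greedy_series a" "partial_sums_pos \<theta> a w ws"
    | "- w \<in> greedy_series a" "partial_sums_pos \<theta> a (- w) (\<lambda>n. - ws n)"
    by (auto simp: partial_sums_def)
  then show ?thesis
  proof cases
    case 1
    then show ?thesis using pos[OF assms(1) 1 assms(4)] by blast
  next
    case 2
    have "(\<lambda>n. conjugate (- ws n)) \<longlonglongrightarrow> conjugate (- z)"
      using tendsto_minus[OF assms(4)] conjugate_uminus assms(1,3) by simp
    then show ?thesis
      using pos[OF _ 2, of "- z"] conjugate_uminus[OF assms(1)] 2(1) by (auto simp: embed_uminus)
  qed
qed

section \<open>Multivalued sums and products of embedded elements\<close>

text \<open>A single term of strict sign suffices to exclude one disjunct of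
  \<open>partial_sums_limit\<close>, hence the existential form.\<close>

lemma multi_addE:
  assumes "x \<in> order" "y \<in> order" "w \<in> multi_add \<theta> a (\<iota> x) (\<iota> y)"
  obtains ws where "partial_sums \<theta> a w ws" "\<And>n. ws n \<in> order"
    "(\<lambda>n. conjugate (ws n)) \<longlonglongrightarrow> conjugate (x + y)"
    "x > 0 \<Longrightarrow> y > 0 \<Longrightarrow> \<exists>n. ws n > 0" "x < 0 \<Longrightarrow> y < 0 \<Longrightarrow> \<exists>n. ws n < 0"
proof -
  obtain xs ys where s: "partial_sums \<theta> a (\<iota> x) xs" "partial_sums \<theta> a (\<iota> y) ys"
    "partial_sums \<theta> a w (\<lambda>n. xs n + ys n)"
    using assms(3) by (auto simp: multi_add_def)
  note X = partial_sums_embed[OF assms(1) s(1)] and Y = partial_sums_embed[OF assms(2) s(2)]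
  have add: "xs n + ys n \<in> order \<and> conjugate (xs n + ys n) = conjugate (xs n) + conjugate (ys n)" for n
    using conjugate_add X Y by blast
  have "(\<lambda>n. conjugate (xs n) + conjugate (ys n)) \<longlonglongrightarrow> conjugate x + conjugate y"
    using X Y by (intro tendsto_add) auto
  moreover have "\<exists>n. xs n + ys n > 0" if "x > 0" "y > 0"
  proof -
    have "eventually (\<lambda>n. xs n > 0 \<and> ys n > 0) sequentially"
      using X Y that by (intro eventually_conj) auto
    then obtain n where "xs n > 0" "ys n > 0" using eventually_happens by force
    then show ?thesis by (intro exI[of _ n]) simp
  qed
  moreover have "\<exists>n. xs n + ys n < 0" if "x < 0" "y < 0"
  proof -
    have "eventually (\<lambda>n. xs n < 0 \<and> ys n < 0) sequentially"
      using X Y that by (intro eventually_conj) auto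
    then obtain n where "xs n < 0" "ys n < 0" using eventually_happens by force
    then show ?thesis by (intro exI[of _ n]) simp
  qed
  ultimately show ?thesis
    using that[OF s(3)] add conjugate_add[OF assms(1,2)] by simp
qed

lemma embed_add_mem:
  assumes "x \<in> order" "y \<in> order"
  shows "\<iota> (x + y) \<in> multi_add \<theta> a (\<iota> x) (\<iota> y)"
  unfolding multi_add_def
  using assms conjugate_add[OF assms] embed_in_O_theta partial_sums_const by blast

text \<open>The factors eventually have the signs of \<open>x\<close> and \<open>y\<close>, and
  signs multiply. So the sign of the product is always known, in contrast to sums.\<close>

lemma multi_mult_embed:
  assumes "x \<in> order" "y \<in> order"
  shows "multi_mult \<theta> a (\<iota> x) (\<iota> y) = {\<iota> (x * y)}"
proof (intro equalityI subsetI)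
  fix w assume "w \<in> multi_mult \<theta> a (\<iota> x) (\<iota> y)"
  then obtain xs ys where s: "partial_sums \<theta> a (\<iota> x) xs" "partial_sums \<theta> a (\<iota> y) ys"
    "partial_sums \<theta> a w (\<lambda>n. xs n * ys n)"
    by (auto simp: multi_mult_def)
  note X = partial_sums_embed[OF assms(1) s(1)] and Y = partial_sums_embed[OF assms(2) s(2)]
  have mult: "xs n * ys n \<in> order \<and> conjugate (xs n * ys n) = conjugate (xs n) * conjugate (ys n)" for n
    using conjugate_mult X Y by blast
  have "(\<lambda>n. conjugate (xs n) * conjugate (ys n)) \<longlonglongrightarrow> conjugate x * conjugate y"
    using X Y by (intro tendsto_mult) auto
  then have lim: "(\<lambda>n. conjugate (xs n * ys n)) \<longlonglongrightarrow> conjugate (x * y)"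
    using mult conjugate_mult[OF assms] by simp
  have sgn_eq: "\<exists>n. sgn (xs n * ys n) = sgn (x * y)" if "x * y \<noteq> 0"
  proof -
    have "eventually (\<lambda>n. sgn (xs n) = sgn x) sequentially"
      using X that by (cases "x > 0") (auto elim!: eventually_mono)
    moreover have "eventually (\<lambda>n. sgn (ys n) = sgn y) sequentially"
      using Y that by (cases "y > 0") (auto elim!: eventually_mono)
    ultimately have "eventually (\<lambda>n. sgn (xs n * ys n) = sgn (x * y)) sequentially"
      by eventually_elim (simp add: sgn_mult)
    then show ?thesis using eventually_happens by force
  qed
  have "x * y \<in> order" using conjugate_mult[OF assms] by simp
  note w = partial_sums_limit[OF this s(3) _ lim]
  consider "x * y = 0" | "x * y > 0" | "x * y < 0" by linarith
  then have "w = \<iota> (x * y)"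
  proof cases
    \<comment> \<open>For a zero product both disjuncts of \<open>partial_sums_limit\<close> give
      the same \<open>w\<close>.\<close>
    case 1
    then show ?thesis using w mult by auto
  next
    case 2
    then obtain n where "xs n * ys n > 0" using sgn_eq sgn_greater by (metis less_irrefl)
    then show ?thesis using w mult 2 by (meson less_imp_le not_less)
  next
    case 3
    then obtain n where "xs n * ys n < 0" using sgn_eq sgn_less by (metis less_irrefl)
    then show ?thesis using w mult 3 by (meson less_imp_le not_less)
  qed
  then show "w \<in> {\<iota> (x * y)}" by simp
next
  fix w assume "w \<in> {\<iota> (x * y)}"
  then show "w \<in> multi_mult \<theta> a (\<iota> x) (\<iota> y)"
    unfolding multi_mult_def
    using assms conjugate_mult[OF assms] embed_in_O_theta partial_sums_const by blast
qed

lemma multi_add_embedded: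
  assumes "x \<in> order" "y \<in> order"
  shows "multi_add \<theta> a (\<iota> x) (\<iota> y) \<inter> \<iota> ` order = {\<iota> (x + y)}"
proof -
  have xy: "x + y \<in> order" using conjugate_add[OF assms] by simp
  have "t = x + y" if "t \<in> order" "\<iota> t \<in> multi_add \<theta> a (\<iota> x) (\<iota> y)" for t
    using multi_addE[OF assms that(2)] partial_sums_limit_embedded[OF that(1) xy] by metis
  then show ?thesis using embed_add_mem[OF assms] xy by blast
qed

lemma multi_add_same_sign:
  assumes "x \<in> order" "y \<in> order" "x * y > 0 \<or> x + y = 0"
  shows "multi_add \<theta> a (\<iota> x) (\<iota> y) = {\<iota> (x + y)}"
proof -
  have xy: "x + y \<in> order" using conjugate_add[OF assms(1,2)] by simp
  have "w = \<iota> (x + y)" if mem: "w \<in> multi_add \<theta> a (\<iota> x) (\<iota> y)" for w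
  proof -
    obtain ws where ws: "partial_sums \<theta> a w ws" "\<And>n. ws n \<in> order"
      "(\<lambda>n. conjugate (ws n)) \<longlonglongrightarrow> conjugate (x + y)"
      "x > 0 \<Longrightarrow> y > 0 \<Longrightarrow> \<exists>n. ws n > 0" "x < 0 \<Longrightarrow> y < 0 \<Longrightarrow> \<exists>n. ws n < 0"
      using multi_addE[OF assms(1,2) mem] by metis
    note w = partial_sums_limit[OF xy ws(1-3)]
    consider "x + y = 0" | "x > 0" "y > 0" | "x < 0" "y < 0"
      using assms(3) by (auto simp: zero_less_mult_iff)
    then show ?thesis
    proof cases
      case 1
      then show ?thesis using w by auto
    next
      case 2
      then show ?thesis using w ws(4) by (meson add_pos_pos less_imp_le not_less)
    next
      case 3
      then show ?thesis using w ws(5) by (meson add_neg_neg less_imp_le not_less)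
    qed
  qed
  then show ?thesis using embed_add_mem[OF assms(1,2)] by blast
qed

lemma multi_add_greedy_series:
  assumes "x \<in> order" "y \<in> order" "x + y \<ge> 0"
  shows "multi_add \<theta> a (\<iota> x) (\<iota> y) \<inter> greedy_series a = {\<iota> (x + y)}"
proof -
  have xy: "x + y \<in> order" using conjugate_add[OF assms(1,2)] by simp
  have "w = \<iota> (x + y)" if mem: "w \<in> multi_add \<theta> a (\<iota> x) (\<iota> y)" "w \<in> greedy_series a" for w
  proof -
    obtain ws where ws: "partial_sums \<theta> a w ws" "\<And>n. ws n \<in> order"
      "(\<lambda>n. conjugate (ws n)) \<longlonglongrightarrow> conjugate (x + y)"
      using multi_addE[OF assms(1,2) mem(1)] by metis
    show ?thesis
    \<comment> \<open>If both signs are possible, \<open>w\<close> is zero and injectivity of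
      conjugation decides; otherwise only the positive disjunct remains.\<close>
    proof (cases "- w \<in> greedy_series a")
      case True
      then have "w = \<iota> 0" using greedy_series_uminus_eq_0[OF mem(2)] by (simp add: embed_0)
      then show ?thesis
        using partial_sums_limit_embedded[OF conjugate_0(1) xy] ws by metis
    next
      case False
      then show ?thesis using partial_sums_limit[OF xy ws] assms(3) by blast
    qed
  qed
  then show ?thesis
    using embed_add_mem[OF assms(1,2)] embed_nonneg(1)[OF xy assms(3)]
      greedy_poly_in_greedy_series by blast
qed

lemma multi_add_uminus:
  "multi_add \<theta> a (- x) (- y) = uminus ` multi_add \<theta> a x y"
proof -
  have sub: "- w \<in> multi_add \<theta> a (- x) (- y)" if w: "w \<in> multi_add \<theta> a x y" for w x y
  proof -
    obtain xs ys where s: "partial_sums \<theta> a x xs" "partial_sums \<theta> a y ys"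
      "partial_sums \<theta> a w (\<lambda>n. xs n + ys n)"
      using w by (auto simp: multi_add_def)
    have "partial_sums \<theta> a (- w) (\<lambda>n. - xs n + - ys n)"
      using s(3) partial_sums_uminus[of \<theta> a w "\<lambda>n. xs n + ys n"] by simp
    moreover have "- w \<in> O_theta a"
      using w by (auto simp: multi_add_def O_theta_def)
    ultimately show ?thesis
      unfolding multi_add_def using s(1,2)[THEN partial_sums_uminus[THEN iffD2]] by blast
  qed
  show ?thesis
    \<comment> \<open>The second instance gives the reverse inclusion, negation being an
      involution.\<close>
    using sub[of _ x y] sub[of _ "- x" "- y"] by (force intro: image_eqI[where x = "- _"])
qed

lemma multi_add_uminus_greedy_series:
  assumes "x \<in> order" "y \<in> order" "x + y \<le> 0"
  shows "multi_add \<theta> a (\<iota> x) (\<iota> y) \<inter> uminus ` greedy_series a = {\<iota> (x + y)}"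
proof -
  have "multi_add \<theta> a (\<iota> x) (\<iota> y) \<inter> uminus ` greedy_series a
    = uminus ` (multi_add \<theta> a (\<iota> (- x)) (\<iota> (- y)) \<inter> greedy_series a)"
    by (simp add: embed_uminus multi_add_uminus image_Int image_image)
  also have "\<dots> = uminus ` {\<iota> (- x + - y)}"
    using assms conjugate_uminus by (subst multi_add_greedy_series) auto
  also have "\<dots> = {\<iota> (x + y)}"
    using embed_uminus[of "x + y"] by simp
  finally show ?thesis .
qed

text \<open>The constant sequence \<open>y\<close> is a sequence of partial sums of the common
  image, and its conjugate limit determines the preimage.\<close>

lemma inj_on_embed: "inj_on \<iota> order"
proof (rule inj_onI)
  fix x y assume "x \<in> order" "y \<in> order" "\<iota> x = \<iota> y"
  moreover have "(\<lambda>n::nat. conjugate y) \<longlonglongrightarrow> conjugate y" by simp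
  ultimately show "x = y"
    using partial_sums_limit_embedded[of x y "\<lambda>n. y"] partial_sums_const[of y] by simp
qed

end

text \<open>For opposite signs the sum set can be larger: if \<open>w\<close> has digits
  \<open>a\<close> at the odd positive positions and \<open>0\<close> elsewhere, its truncation
  below \<open>2k\<close> has value \<open>\<theta>^(2k) - 1\<close>. As
  \<open>2 - (1 + \<theta>^(2k)) = - (\<theta>^(2k) - 1)\<close>, the series \<open>- w\<close> lies
  in \<open>2 + (-1)\<close> besides \<open>1\<close>. Hence the clauses on addition restrict the
  signs or the range of the result. Finite sums of powers of \<open>\<theta>\<close> lie in the
  order, so its equality with \<open>O\<^sub>K\<close> is what gives every element a finite
  expansion up to sign.\<close>

theorem theorem17:
  fixes \<theta> :: real and a :: int
  defines "O\<^sub>K \<equiv> ring_of_integers (quadratic_field \<theta>)"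
    and "\<iota> \<equiv> O_K_embed \<theta> a"
  assumes "\<theta> > 1"
    and "quadratic_integer \<theta> a (- 1)"
    and "O\<^sub>K = quadratic_order \<theta>"
  shows "(\<forall>x\<in>O\<^sub>K. \<forall>y\<in>O\<^sub>K.
           multi_add \<theta> a (\<iota> x) (\<iota> y) \<inter> \<iota> ` O\<^sub>K = {\<iota> (x + y)} \<and>
           (x * y > 0 \<or> x + y = 0 \<longrightarrow> multi_add \<theta> a (\<iota> x) (\<iota> y) = {\<iota> (x + y)}) \<and>
           (x + y \<ge> 0 \<longrightarrow> multi_add \<theta> a (\<iota> x) (\<iota> y) \<inter> greedy_series a = {\<iota> (x + y)}) \<and>
           (x + y \<le> 0 \<longrightarrow> multi_add \<theta> a (\<iota> x) (\<iota> y) \<inter> uminus ` greedy_series a = {\<iota> (x + y)}) \<and>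
           multi_mult \<theta> a (\<iota> x) (\<iota> y) = {\<iota> (x * y)}) \<and>
         \<iota> ` O\<^sub>K \<subseteq> O_theta a \<and> inj_on \<iota> O\<^sub>K \<and> \<iota> 0 = 0 \<and> \<iota> 1 = 1"
proof -
  interpret norm_minus_one_unit \<theta> a
    using assms by unfold_locales
  show ?thesis
    unfolding \<open>O\<^sub>K = quadratic_order \<theta>\<close> \<iota>_def
    using multi_add_embedded multi_add_same_sign multi_add_greedy_series
      multi_add_uminus_greedy_series multi_mult_embed embed_in_O_theta inj_on_embed embed_0 embed_1
    by (intro conjI ballI impI) auto
qed

end
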